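(* If $\lambda$ is a wide partition with at most two distinct part sizes, then $\lambda$ is Latin.
   Context: For partitions $\alpha,\beta$ of the same integer, $\alpha\ge\beta$ (dominance) means $\sum_{k\le j}\alpha_k\ge\sum_{k\le j}\beta_k$ for all $j$; $\mu'$ is the conjugate of $\mu$. $\mu$ is a subpartition of $\lambda$ if the multiset of parts of $\mu$ is a submultiset of that of $\lambda$. $\lambda$ is wide if $\mu\ge\mu'$ for every subpartition $\mu$ of $\lambda$. A tableau of shape $\lambda$ is the Young diagram of $\lambda$ with a positive integer in each cell. $\lambda$ is Latin if there is a tableau of shape $\lambda$ in which no two cells in the same row or column have equal entries and in which, for every $i$, the integer $i$ occurs exactly $\lambda'_i$ times. *)

theory Defs
  imports "HOL-Library.Multiset"
begin

definition int_partition :: "nat list \<Rightarrow> bool" where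
  "int_partition xs \<longleftrightarrow> sorted_wrt (\<ge>) xs \<and> (\<forall>p \<in> set xs. p > 0)"

text \<open>Parts are indexed from 1, and are 0 beyond the length of the list.\<close>

definition part :: "nat list \<Rightarrow> nat \<Rightarrow> nat" where
  "part xs k = (if 1 \<le> k \<and> k \<le> length xs then xs ! (k - 1) else 0)"

definition conjugate_part :: "nat list \<Rightarrow> nat list" where
  "conjugate_part xs = map (\<lambda>j. card {i \<in> {1..length xs}. j \<le> part xs i}) [1..<Suc (part xs 1)]"

definition dominates :: "nat list \<Rightarrow> nat list \<Rightarrow> bool" where
  "dominates a b \<longleftrightarrow>
     sum_list a = sum_list b \<and> (\<forall>j. (\<Sum>k=1..j. part a k) \<ge> (\<Sum>k=1..j. part b k))"

definition subpartition :: "nat list \<Rightarrow> nat list \<Rightarrow> bool" where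
  "subpartition m l \<longleftrightarrow> int_partition m \<and> mset m \<subseteq># mset l"

definition wide :: "nat list \<Rightarrow> bool" where
  "wide l \<longleftrightarrow> (\<forall>m. subpartition m l \<longrightarrow> dominates m (conjugate_part m))"

definition young_diagram :: "nat list \<Rightarrow> (nat \<times> nat) set" where
  "young_diagram l = {(r, c). 1 \<le> r \<and> r \<le> length l \<and> 1 \<le> c \<and> c \<le> part l r}"

text \<open>Only the values of the filling on the cells of the diagram matter.\<close>

definition tableau :: "nat list \<Rightarrow> (nat \<times> nat \<Rightarrow> nat) \<Rightarrow> bool" where
  "tableau l T \<longleftrightarrow> (\<forall>x \<in> young_diagram l. T x > 0)"

definition latin :: "nat list \<Rightarrow> bool" where
  "latin l \<longleftrightarrow> (\<exists>T. tableau l T \<and>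
     (\<forall>x \<in> young_diagram l. \<forall>y \<in> young_diagram l.
        x \<noteq> y \<and> (fst x = fst y \<or> snd x = snd y) \<longrightarrow> T x \<noteq> T y) \<and>
     (\<forall>i\<ge>1. card {x \<in> young_diagram l. T x = i} = part (conjugate_part l) i))"

lemma part_le_part_1:
  assumes "int_partition xs"
  shows "part xs i \<le> part xs 1"
proof (cases "1 < i \<and> i \<le> length xs")
  case True
  have "xs ! 0 \<ge> xs ! (i - 1)"
    using assms True sorted_wrt_nth_less[of "(\<ge>)" xs 0 "i - 1"] by (auto simp: int_partition_def)
  with True show ?thesis by (auto simp: part_def)
next
  case False
  then show ?thesis by (cases "i = 1") (auto simp: part_def)
qed

lemma part_conjugate_part:
  assumes "int_partition xs" "j \<ge> 1"
  shows "part (conjugate_part xs) j = card {i \<in> {1..length xs}. j \<le> part xs i}"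
proof (cases "j \<le> part xs 1")
  case True
  with assms(2) have "[1..<Suc (part xs 1)] ! (j - 1) = j"
    by (subst nth_upt) auto
  with True assms(2) show ?thesis
    unfolding part_def[of "conjugate_part xs"]
    by (simp add: conjugate_part_def del: upt_Suc)
next
  case False
  then have "{i \<in> {1..length xs}. j \<le> part xs i} = {}"
    using part_le_part_1[OF assms(1)] by (fastforce dest: order_trans)
  with False show ?thesis
    unfolding part_def[of "conjugate_part xs"]
    by (simp add: conjugate_part_def del: upt_Suc)
qed

lemma int_partition_conjugate_part:
  assumes "int_partition xs"
  shows "int_partition (conjugate_part xs)"
proof -
  have "card {i \<in> {1..length xs}. j \<le> part xs i} > 0" if "1 \<le> j" "j \<le> part xs 1" for j
  proof -
    have "1 \<in> {i \<in> {1..length xs}. j \<le> part xs i}"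
      using that by (auto simp: part_def split: if_splits)
    then show ?thesis by (auto simp: card_gt_0_iff)
  qed
  moreover have "sorted_wrt (\<ge>) (conjugate_part xs)"
    unfolding conjugate_part_def sorted_wrt_iff_nth_less
    by (auto simp del: upt_Suc intro!: card_mono)
  ultimately show ?thesis
    by (force simp: int_partition_def conjugate_part_def simp del: upt_Suc)
qed

lemma sum_list_conjugate_part:
  assumes "int_partition xs"
  shows "sum_list (conjugate_part xs) = sum_list xs"
proof -
  let ?R = "\<lambda>j i. if j \<le> part xs i then 1 else 0 :: nat"
  have "sum_list (conjugate_part xs)
      = (\<Sum>j\<in>{1..part xs 1}. card {i \<in> {1..length xs}. j \<le> part xs i})"
    unfolding conjugate_part_def
    by (simp add: sum_list_distinct_conv_sum_set atLeastLessThanSuc_atLeastAtMost del: upt_Suc)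
  also have "\<dots> = (\<Sum>j\<in>{1..part xs 1}. \<Sum>i\<in>{1..length xs}. ?R j i)"
    by (simp add: sum.If_cases Int_def)
  also have "\<dots> = (\<Sum>i\<in>{1..length xs}. \<Sum>j\<in>{1..part xs 1}. ?R j i)"
    by (rule sum.swap)
  also have "\<dots> = (\<Sum>i\<in>{1..length xs}. part xs i)"
  proof (rule sum.cong[OF refl])
    fix i
    have "{1..part xs 1} \<inter> {j. j \<le> part xs i} = {1..part xs i}"
      using part_le_part_1[OF assms, of i] by auto
    then show "(\<Sum>j\<in>{1..part xs 1}. ?R j i) = part xs i"
      by (simp add: sum.If_cases)
  qed
  also have "\<dots> = (\<Sum>i<length xs. part xs (Suc i))"
    by (rule sum.reindex_bij_witness[where i = Suc and j = "\<lambda>i. i - 1"]) auto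
  also have "\<dots> = sum_list xs"
    by (simp add: part_def sum_list_sum_nth atLeast0LessThan)
  finally show ?thesis .
qed

end

theory Submission
  imports Defs
begin

text \<open>
  Let \<open>\<lambda>\<close> have \<open>m\<close> parts \<open>a\<close> and \<open>n\<close> parts \<open>b < a\<close>. In a Latin tableau every row of length \<open>k\<close>
  contains exactly the symbols \<open>1, \<dots>, k\<close>, so such a tableau is the same as a proper edge
  colouring, by columns, of the bipartite graph of pairs (row, symbol). Choose for each of the
  \<open>m\<close> long rows the \<open>b\<close> symbols that go into the first \<open>b\<close> columns. If symbol \<open>s\<close> is chosen \<open>t s\<close>
  times, then Koenig's edge colouring theorem, applied separately to the first \<open>b\<close> and the last
  \<open>a - b\<close> columns, completes the tableau as soon as \<open>m - (a - b) \<le> t s\<close> for all \<open>s\<close>,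
  \<open>t s \<le> b - n\<close> for \<open>s \<le> b\<close> and \<open>t s \<le> b\<close> for \<open>s > b\<close>. Such multiplicities \<open>t s \<le> m\<close> with
  sum \<open>m b\<close> exist if \<open>n \<le> b\<close>, \<open>m + n \<le> a\<close> and \<open>b (m + n - b) \<le> m (a - b)\<close>. The first inequality
  is wideness of the rectangle formed by the \<open>n\<close> short rows; the others follow from the
  dominance inequalities of \<open>\<lambda>\<close> itself for the first \<open>1\<close>, \<open>b\<close> and \<open>m\<close> parts.
\<close>

section \<open>Edge colourings of bipartite graphs\<close>

definition proper_edge_colouring :: "('a \<times> 'b) set \<Rightarrow> 'c set \<Rightarrow> ('a \<times> 'b \<Rightarrow> 'c) \<Rightarrow> bool" where
  "proper_edge_colouring E K c \<longleftrightarrow>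
     (\<forall>e\<in>E. c e \<in> K) \<and>
     (\<forall>x y y'. (x, y) \<in> E \<longrightarrow> (x, y') \<in> E \<longrightarrow> c (x, y) = c (x, y') \<longrightarrow> y = y') \<and>
     (\<forall>x x' y. (x, y) \<in> E \<longrightarrow> (x', y) \<in> E \<longrightarrow> c (x, y) = c (x', y) \<longrightarrow> x = x')"

lemma proper_edge_colouringD:
  assumes "proper_edge_colouring E K c"
  shows "e \<in> E \<Longrightarrow> c e \<in> K"
    and "(x, y) \<in> E \<Longrightarrow> (x, y') \<in> E \<Longrightarrow> c (x, y) = c (x, y') \<Longrightarrow> y = y'"
    and "(x, y) \<in> E \<Longrightarrow> (x', y) \<in> E \<Longrightarrow> c (x, y) = c (x', y) \<Longrightarrow> x = x'"
  using assms unfolding proper_edge_colouring_def by blast+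

text \<open>The right-hand vertices of the alternating path that leaves \<open>v\<close> along colour \<open>\<alpha>\<close>.\<close>

inductive_set kempe_chain :: "('a \<times> 'b) set \<Rightarrow> ('a \<times> 'b \<Rightarrow> 'c) \<Rightarrow> 'c \<Rightarrow> 'c \<Rightarrow> 'b \<Rightarrow> 'b set"
  for E c \<alpha> \<beta> v where
  kempe_start: "v \<in> kempe_chain E c \<alpha> \<beta> v"
| kempe_step: "y \<in> kempe_chain E c \<alpha> \<beta> v \<Longrightarrow> (x, y) \<in> E \<Longrightarrow> c (x, y) = \<alpha> \<Longrightarrow>
    (x, y') \<in> E \<Longrightarrow> c (x, y') = \<beta> \<Longrightarrow> y' \<in> kempe_chain E c \<alpha> \<beta> v"

text \<open>Swapping \<open>\<alpha>\<close> and \<open>\<beta>\<close> along the alternating path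
  from \<open>v\<close> frees \<open>\<alpha>\<close> at \<open>v\<close>. The path enters left-hand
  vertices only along \<open>\<alpha>\<close>, so it misses \<open>u\<close>, where
  \<open>\<alpha>\<close> stays free for the new edge.\<close>

lemma proper_edge_colouring_insert:
  assumes proper: "proper_edge_colouring E K c"
    and col: "\<alpha> \<in> K" "\<beta> \<in> K"
    and free_u: "\<And>y. (u, y) \<in> E \<Longrightarrow> c (u, y) \<noteq> \<alpha>"
    and free_v: "\<And>x. (x, v) \<in> E \<Longrightarrow> c (x, v) \<noteq> \<beta>"
  shows "\<exists>c'. proper_edge_colouring (insert (u, v) E) K c'"
proof (cases "(u, v) \<in> E")
  case True
  with proper show ?thesis by (auto simp: insert_absorb)
next
  case False
  note D = proper_edge_colouringD[OF proper]
  let ?R = "kempe_chain E c \<alpha> \<beta> v"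
  define sw where "sw k = (if k = \<alpha> then \<beta> else if k = \<beta> then \<alpha> else k)" for k
  define c' where "c' = (\<lambda>(x, y). if y \<in> ?R then sw (c (x, y)) else c (x, y))"
  have sw_inj: "sw k = sw k' \<longleftrightarrow> k = k'" for k k'
    unfolding sw_def by auto
  have sw_K: "sw k \<in> K" if "k \<in> K" for k
    using that col unfolding sw_def by simp
  \<comment> \<open>The chain can be traced backwards: a \<open>\<beta>\<close>-edge at a chain
    vertex is the one by which the chain arrived, since \<open>v\<close> itself has no
    \<open>\<beta>\<close>-edge.\<close>
  have pred: "\<exists>y. y \<in> ?R \<and> (x, y) \<in> E \<and> c (x, y) = \<alpha>"
    if "y' \<in> ?R" "(x, y') \<in> E" "c (x, y') = \<beta>" for x y'
    using that(1)
  proof cases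
    case kempe_start
    with free_v that show ?thesis by blast
  next
    case (kempe_step y x')
    then show ?thesis using D(3) that by metis
  qed
  \<comment> \<open>The two edges coloured \<open>\<alpha>\<close> and \<open>\<beta>\<close> at a
    left-hand vertex are swapped together or not at all, which excludes the only possible new
    conflict there.\<close>
  have chain_iff: "y \<in> ?R \<longleftrightarrow> y' \<in> ?R"
    if "(x, y) \<in> E" "c (x, y) = \<alpha>" "(x, y') \<in> E" "c (x, y') = \<beta>" for x y y'
    using that kempe_chain.kempe_step[of y E c \<alpha> \<beta> v x y'] pred[of y' x] D(2)[of x y] by metis
  have proper_x: "y = y'" if "(x, y) \<in> E" "(x, y') \<in> E" "c' (x, y) = c' (x, y')" for x y y'
  proof (rule ccontr)
    assume "y \<noteq> y'"
    then have ne: "c (x, y) \<noteq> c (x, y')" using D(2) that by blast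
    have "y \<in> ?R \<longleftrightarrow> y' \<notin> ?R"
      using ne that(3) unfolding c'_def by (auto simp: sw_inj split: if_splits)
    moreover have "c (x, y) = \<alpha> \<and> c (x, y') = \<beta> \<or> c (x, y) = \<beta> \<and> c (x, y') = \<alpha>"
      using ne that(3) calculation unfolding c'_def sw_def by (auto split: if_splits)
    ultimately show False using chain_iff that(1,2) by blast
  qed
  have proper_y: "x = x'" if "(x, y) \<in> E" "(x', y) \<in> E" "c' (x, y) = c' (x', y)" for x x' y
    using D(3)[OF that(1,2)] that(3) unfolding c'_def by (auto simp: sw_inj split: if_splits)
  have c'_u: "c' (u, y) \<noteq> \<alpha>" if "(u, y) \<in> E" for y
    using that free_u pred[of y u] unfolding c'_def sw_def by (auto split: if_splits)
  have c'_v: "c' (x, v) \<noteq> \<alpha>" if "(x, v) \<in> E" for x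
    using that free_v kempe_chain.kempe_start[of v E c \<alpha> \<beta>] unfolding c'_def sw_def
    by (auto split: if_splits)
  have c'_K: "c' e \<in> K" if "e \<in> E" for e
    using that D(1) sw_K unfolding c'_def by (auto split: prod.splits)
  have "proper_edge_colouring (insert (u, v) E) K (c'((u, v) := \<alpha>))"
    unfolding proper_edge_colouring_def
  proof (intro conjI allI impI ballI)
    fix e assume "e \<in> insert (u, v) E"
    then show "(c'((u, v) := \<alpha>)) e \<in> K" using c'_K[of e] col by auto
  next
    fix x y y'
    assume "(x, y) \<in> insert (u, v) E" "(x, y') \<in> insert (u, v) E"
      "(c'((u, v) := \<alpha>)) (x, y) = (c'((u, v) := \<alpha>)) (x, y')"
    then show "y = y'"
      using proper_x[of x y y'] c'_u[of y] c'_u[of y'] by (auto split: if_splits)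
  next
    fix x x' y
    assume "(x, y) \<in> insert (u, v) E" "(x', y) \<in> insert (u, v) E"
      "(c'((u, v) := \<alpha>)) (x, y) = (c'((u, v) := \<alpha>)) (x', y)"
    then show "x = x'"
      using proper_y[of x y x'] c'_v[of x] c'_v[of x'] by (auto split: if_splits)
  qed
  then show ?thesis by blast
qed

lemma missing_value:
  assumes "finite A" "card A < card K"
  shows "\<exists>k\<in>K. \<forall>y\<in>A. f y \<noteq> k"
proof (rule ccontr)
  assume "\<not> ?thesis"
  then have "K \<subseteq> f ` A" by auto
  then have "card K \<le> card A"
    using assms(1) by (meson card_image_le card_mono finite_imageI order_trans)
  with assms(2) show False by simp
qed

text \<open>Edges are added one at a time. Each endpoint of the new edge has fewer than
  \<open>card K\<close> old edges, so it misses a colour; the path swap reconciles the two missing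
  colours.\<close>

theorem Koenig_edge_colouring:
  assumes "finite E" "finite K"
    and "\<And>x. card {y. (x, y) \<in> E} \<le> card K"
    and "\<And>y. card {x. (x, y) \<in> E} \<le> card K"
  shows "\<exists>c. proper_edge_colouring E K c"
  using assms(1,3,4)
proof (induction E rule: finite_induct)
  case empty
  then show ?case by (simp add: proper_edge_colouring_def)
next
  case (insert e E)
  obtain u v where e: "e = (u, v)" by force
  have fin: "finite {y. (x, y) \<in> E}" "finite {x. (x, y) \<in> E}" for x y
    using finite_imageI[OF \<open>finite E\<close>, of snd] finite_imageI[OF \<open>finite E\<close>, of fst]
    by (auto elim!: finite_subset[rotated] simp: image_iff Bex_def)
  have row: "{y. (x, y) \<in> insert e E} = (if x = u then insert v {y. (x, y) \<in> E}
      else {y. (x, y) \<in> E})" for x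
    using e by auto
  have colm: "{x. (x, y) \<in> insert e E} = (if y = v then insert u {x. (x, y) \<in> E}
      else {x. (x, y) \<in> E})" for y
    using e by auto
  have du: "card {y. (u, y) \<in> E} < card K"
    using insert.prems(1)[of u] insert.hyps(2) e fin unfolding row by simp
  have dv: "card {x. (x, v) \<in> E} < card K"
    using insert.prems(2)[of v] insert.hyps(2) e fin unfolding colm by simp
  have "card {y. (x, y) \<in> E} \<le> card K" for x
    using insert.prems(1)[of x] du unfolding row by (auto split: if_splits)
  moreover have "card {x. (x, y) \<in> E} \<le> card K" for y
    using insert.prems(2)[of y] dv unfolding colm by (auto split: if_splits)
  ultimately obtain c where c: "proper_edge_colouring E K c"
    using insert.IH by blast
  obtain \<alpha> where "\<alpha> \<in> K" "\<And>y. (u, y) \<in> E \<Longrightarrow> c (u, y) \<noteq> \<alpha>"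
    using missing_value[OF fin(1) du, of "\<lambda>y. c (u, y)"] by blast
  moreover obtain \<beta> where "\<beta> \<in> K" "\<And>x. (x, v) \<in> E \<Longrightarrow> c (x, v) \<noteq> \<beta>"
    using missing_value[OF fin(2) dv, of "\<lambda>x. c (x, v)"] by blast
  ultimately show ?case
    using proper_edge_colouring_insert[OF c] e by blast
qed

section \<open>Matrices with prescribed margins\<close>

lemma exists_sum_between:
  fixes lo hi :: "'a \<Rightarrow> nat"
  assumes "finite A" "\<And>s. s \<in> A \<Longrightarrow> lo s \<le> hi s" "sum lo A \<le> N" "N \<le> sum hi A"
  shows "\<exists>t. (\<forall>s\<in>A. lo s \<le> t s \<and> t s \<le> hi s) \<and> sum t A = N"
  using assms
proof (induction A arbitrary: N rule: finite_induct)
  case empty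
  then show ?case by simp
next
  case (insert x A)
  \<comment> \<open>Greedy choice: as much as possible at \<open>x\<close> while leaving the lower
    bounds on \<open>A\<close> attainable.\<close>
  define v where "v = min (hi x) (N - sum lo A)"
  have "lo x \<le> hi x" using insert.prems by simp
  then have v: "lo x \<le> v" "v \<le> hi x" "v \<le> N" "sum lo A \<le> N - v" "N - v \<le> sum hi A"
    using insert.prems(2,3) insert.hyps sum_mono[of A lo hi] insert.prems(1)
    unfolding v_def by auto
  obtain t where t: "\<forall>s\<in>A. lo s \<le> t s \<and> t s \<le> hi s" "sum t A = N - v"
    using insert.IH[of "N - v"] insert.prems(1) v by auto
  have "sum (t(x := v)) A = sum t A"
    using insert.hyps by (intro sum.cong) auto
  then show ?case
    using t v insert.hyps by (intro exI[of _ "t(x := v)"]) auto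
qed

lemma inj_on_mod_interval: "t \<le> m \<Longrightarrow> inj_on (\<lambda>p. p mod m) {s..<s + t}" for m :: nat
proof (rule inj_onI)
  fix p q assume *: "t \<le> m" "p \<in> {s..<s + t}" "q \<in> {s..<s + t}" "p mod m = q mod m"
  have "p = q" if "p \<le> q" "p mod m = q mod m" "q < p + m" for p q :: nat
  proof -
    have "m dvd q - p" using that(1,2) by (metis mod_eq_dvd_iff_nat)
    moreover have "q - p < m" using that by linarith
    ultimately show ?thesis using that(1) by (metis dvd_imp_le not_less diff_is_0_eq gr0I le_antisym)
  qed
  note le = this
  have "q < p + m" "p < q + m" using *(1-3) by auto
  then show "p = q" using le[of p q] le[of q p] *(4) nat_le_linear[of p q] by metis
qed

text \<open>Write each symbol \<open>s\<close> as a block of \<open>t s\<close> consecutive positions and send position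
  \<open>p\<close> to row \<open>p mod m\<close>: a block no longer than \<open>m\<close> meets every row at most once.\<close>

lemma exists_relation_with_margins:
  fixes t :: "nat \<Rightarrow> nat"
  assumes "\<And>s. s < a \<Longrightarrow> t s \<le> m" "(\<Sum>s<a. t s) = m * b"
  shows "\<exists>P \<subseteq> {..<m} \<times> {..<a}.
    (\<forall>r<m. card {s. (r, s) \<in> P} = b) \<and> (\<forall>s<a. card {r. (r, s) \<in> P} = t s)"
proof -
  define S where "S k = (\<Sum>s<k. t s)" for k
  define P where "P = {(r, s). r < m \<and> s < a \<and> (\<exists>p\<in>{S s..<S s + t s}. p mod m = r)}"
  have inj: "inj_on (\<lambda>p. p mod m) {S s..<S s + t s}" if "s < a" for s
    using inj_on_mod_interval assms(1) that by blast
  have "card {r. (r, s) \<in> P} = t s" if "s < a" for s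
  proof -
    have "{r. (r, s) \<in> P} = (\<lambda>p. p mod m) ` {S s..<S s + t s}"
      using that assms(1)[OF that] unfolding P_def by (auto intro!: mod_less_divisor)
    then show ?thesis using card_image[OF inj[OF that]] by simp
  qed
  moreover have "card {s. (r, s) \<in> P} = b" if r: "r < m" for r
  proof -
    \<comment> \<open>Block \<open>k\<close> contains at most one position of residue
      \<open>r\<close>, so counting symbols in row \<open>r\<close> amounts to counting such
      positions.\<close>
    have "card {s. s < k \<and> (r, s) \<in> P} = card {p. p < S k \<and> p mod m = r}" if "k \<le> a" for k
      using that
    proof (induction k)
      case 0
      then show ?case by (simp add: S_def)
    next
      case (Suc k)
      let ?B = "{p\<in>{S k..<S k + t k}. p mod m = r}"
      have "card ?B = (if (r, k) \<in> P then 1 else 0)"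
      proof (cases "(r, k) \<in> P")
        case True
        then obtain p where "p \<in> ?B" unfolding P_def by auto
        then have "?B = {p}" using inj[of k] Suc.prems unfolding inj_on_def by auto
        with True show ?thesis by simp
      next
        case False
        then have "?B = {}" using r Suc.prems unfolding P_def by auto
        with False show ?thesis by (simp only: card.empty if_False)
      qed
      moreover have "{p. p < S (Suc k) \<and> p mod m = r} = {p. p < S k \<and> p mod m = r} \<union> ?B"
        unfolding S_def by auto
      moreover have "card ({p. p < S k \<and> p mod m = r} \<union> ?B)
          = card {p. p < S k \<and> p mod m = r} + card ?B"
        by (rule card_Un_disjoint) auto
      moreover have "{s. s < Suc k \<and> (r, s) \<in> P} =
          {s. s < k \<and> (r, s) \<in> P} \<union> (if (r, k) \<in> P then {k} else {})"
        by (auto simp: less_Suc_eq)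
      ultimately show ?case using Suc by (auto simp: card_insert_if)
    qed
    \<comment> \<open>The blocks together tile the positions below \<open>m * b\<close>, where every
      residue modulo \<open>m\<close> occurs \<open>b\<close> times.\<close>
    from this[of a] have "card {s. (r, s) \<in> P} = card {p. p < m * b \<and> p mod m = r}"
      using assms(2) unfolding P_def S_def by (simp add: conj_ac cong: conj_cong)
    also have "{p. p < m * b \<and> p mod m = r} = (\<lambda>q. r + m * q) ` {..<b}"
    proof (intro equalityI subsetI)
      fix p assume p: "p \<in> {p. p < m * b \<and> p mod m = r}"
      then have "p = r + m * (p div m)" "p div m < b"
        by (auto simp: less_mult_imp_div_less mult.commute)
      then show "p \<in> (\<lambda>q. r + m * q) ` {..<b}" by blast
    next
      fix p assume "p \<in> (\<lambda>q. r + m * q) ` {..<b}"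
      then obtain q where q: "q < b" "p = r + m * q" by auto
      then have "p < m * Suc q" using r by simp
      also have "\<dots> \<le> m * b" using q by (intro mult_le_mono) auto
      finally show "p \<in> {p. p < m * b \<and> p mod m = r}" using q r by simp
    qed
    also have "card \<dots> = b"
      using r by (subst card_image) (auto simp: inj_on_def)
    finally show ?thesis .
  qed
  moreover have "P \<subseteq> {..<m} \<times> {..<a}" unfolding P_def by auto
  ultimately show ?thesis by blast
qed

section \<open>Latin tableaux\<close>

text \<open>Here \<open>c r s\<close> is the column of the cell of row \<open>r\<close> that contains the symbol \<open>s\<close>.\<close>

lemma latin_if_column_assignment:
  assumes l: "int_partition l"
    and into: "\<And>r s. (r, s) \<in> young_diagram l \<Longrightarrow> (r, c r s) \<in> young_diagram l"
    and inj_row: "\<And>r s s'. (r, s) \<in> young_diagram l \<Longrightarrow> (r, s') \<in> young_diagram l \<Longrightarrow>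
      c r s = c r s' \<Longrightarrow> s = s'"
    and inj_sym: "\<And>r r' s. (r, s) \<in> young_diagram l \<Longrightarrow> (r', s) \<in> young_diagram l \<Longrightarrow>
      c r s = c r' s \<Longrightarrow> r = r'"
  shows "latin l"
proof -
  let ?Y = "young_diagram l"
  have Y: "(r, s) \<in> ?Y \<longleftrightarrow> s \<in> {1..part l r}" for r s
    by (auto simp: young_diagram_def part_def)
  \<comment> \<open>The diagram doubles as the set of pairs (row, symbol), so \<open>c r\<close>
    permutes \<open>{1..part l r}\<close> and its inverse reads off the filling of row
    \<open>r\<close>.\<close>
  define T where "T = (\<lambda>(r, j). inv_into {1..part l r} (c r) j)"
  have bij: "bij_betw (c r) {1..part l r} {1..part l r}" for r
    unfolding bij_betw_def
  proof
    show inj: "inj_on (c r) {1..part l r}"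
      by (rule inj_onI) (metis Y inj_row)
    show "c r ` {1..part l r} = {1..part l r}"
      by (rule endo_inj_surj[OF _ _ inj]) (use into Y in blast)+
  qed
  have T1: "(r, T (r, j)) \<in> ?Y" "c r (T (r, j)) = j" if "(r, j) \<in> ?Y" for r j
    using that bij_betw_inv_into_right[OF bij] bij_betwE[OF bij_betw_inv_into[OF bij]]
    unfolding Y T_def by auto
  have T2: "T (r, c r s) = s" if "(r, s) \<in> ?Y" for r s
    using that bij_betw_inv_into_left[OF bij] unfolding Y T_def by auto
  show ?thesis
    unfolding latin_def
  proof (intro exI[of _ T] conjI ballI impI allI)
    show "tableau l T"
      using T1(1) unfolding tableau_def young_diagram_def by fastforce
  next
    fix x y assume xy: "x \<in> ?Y" "y \<in> ?Y" "x \<noteq> y \<and> (fst x = fst y \<or> snd x = snd y)"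
    obtain r j r' j' where [simp]: "x = (r, j)" "y = (r', j')" by fastforce
    show "T x \<noteq> T y"
    proof
      assume "T x = T y"
      then show False using xy T1[of r j] T1[of r' j'] inj_sym by auto
    qed
  next
    fix i :: nat assume i: "1 \<le> i"
    \<comment> \<open>Symbol \<open>i\<close> occurs exactly once in each row of length at least
      \<open>i\<close>, and the conjugate part counts these rows.\<close>
    have "bij_betw (\<lambda>r. (r, c r i)) {r \<in> {1..length l}. i \<le> part l r} {x \<in> ?Y. T x = i}"
    proof (rule bij_betw_byWitness[where f' = fst])
      show "(\<lambda>r. (r, c r i)) ` {r \<in> {1..length l}. i \<le> part l r} \<subseteq> {x \<in> ?Y. T x = i}"
        using i into T2 by (auto simp: Y)
      show "fst ` {x \<in> ?Y. T x = i} \<subseteq> {r \<in> {1..length l}. i \<le> part l r}"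
        using T1(1) by (fastforce simp: young_diagram_def)
    qed (use T1(2) in auto)
    then show "card {x \<in> ?Y. T x = i} = part (conjugate_part l) i"
      using part_conjugate_part[OF l i] by (simp add: bij_betw_same_card)
  qed
qed

section \<open>Partitions with two part sizes\<close>

lemma sorted_two_values:
  fixes a b :: "'a::linorder"
  assumes "sorted_wrt (\<ge>) l" "set l \<subseteq> {a, b}" "b < a"
  shows "\<exists>m n. l = replicate m a @ replicate n b"
  using assms
proof (induction l)
  case Nil
  then show ?case by (intro exI[of _ 0]) simp
next
  case (Cons x xs)
  then obtain m n where xs: "xs = replicate m a @ replicate n b" by auto
  show ?case
  proof (cases "x = a")
    case True
    with xs show ?thesis by (intro exI[of _ "Suc m"] exI[of _ n]) simp
  next
    case False
    then have "x = b" using Cons.prems by auto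
    moreover from this have "m = 0" using Cons.prems xs by (cases m) auto
    ultimately show ?thesis using xs by (intro exI[of _ 0] exI[of _ "Suc n"]) simp
  qed
qed

lemma two_part_sizes:
  assumes "int_partition l" "card (set l) \<le> 2"
  obtains a b m n where "0 < b" "b < a" "l = replicate m a @ replicate n b"
proof -
  have "\<exists>a b. 0 < b \<and> b < a \<and> set l \<subseteq> {a, b}"
  proof (cases "card (set l) = 2")
    case True
    then obtain x y where "set l = {x, y}" "x \<noteq> y" by (meson card_2_iff)
    moreover have "0 < x" "0 < y" using assms(1) calculation by (auto simp: int_partition_def)
    ultimately show ?thesis
      by (cases "x < y") (auto intro: exI[of _ x] exI[of _ y])
  next
    case False
    then have "card (set l) \<le> Suc 0" using assms(2) by simp
    then have "\<exists>b>0. set l \<subseteq> {b}"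
      using assms(1) by (cases l) (auto simp: int_partition_def card_le_Suc0_iff_eq)
    \<comment> \<open>A single part size plays the role of \<open>b\<close>; \<open>Suc b\<close> is
      a dummy larger size.\<close>
    then show ?thesis by (metis insert_iff lessI subset_iff)
  qed
  then obtain a b where ab: "0 < b" "b < a" "set l \<subseteq> {a, b}" by blast
  then obtain m n where "l = replicate m a @ replicate n b"
    using sorted_two_values[of l a b] assms(1) unfolding int_partition_def by blast
  then show ?thesis using that ab by blast
qed

text \<open>This is dominance at \<open>j = 1\<close>: the first part of the conjugate is the number
  of parts.\<close>

lemma dominates_conjugate_length_le:
  assumes "int_partition l" "l \<noteq> []" "dominates l (conjugate_part l)"
  shows "length l \<le> l ! 0"
proof -
  have "{i \<in> {1..length l}. 1 \<le> part l i} = {1..length l}"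
    using assms(1) by (auto simp: part_def int_partition_def Suc_le_eq)
  then have "part (conjugate_part l) 1 = length l"
    using part_conjugate_part[OF assms(1), of 1] by simp
  moreover have "part (conjugate_part l) 1 \<le> part l 1"
    using assms(3) unfolding dominates_def by (auto dest: spec[of _ 1])
  ultimately show ?thesis using assms(2) by (simp add: part_def Suc_le_eq)
qed

lemma int_partition_two_sizes:
  "0 < b \<Longrightarrow> b < a \<Longrightarrow> int_partition (replicate m a @ replicate n b)"
  unfolding int_partition_def sorted_wrt_append
  by (auto simp: sorted_wrt_iff_nth_less)

lemma part_two_sizes:
  "part (replicate m a @ replicate n b) k =
    (if 1 \<le> k \<and> k \<le> m then a else if m < k \<and> k \<le> m + n then b else 0)"
  by (auto simp: part_def nth_append)

lemma part_conjugate_two_sizes: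
  assumes "0 < b" "b < a" "1 \<le> k"
  shows "part (conjugate_part (replicate m a @ replicate n b)) k =
    (if k \<le> b then m + n else if k \<le> a then m else 0)"
proof -
  have "{i \<in> {1..m + n}. k \<le> part (replicate m a @ replicate n b) i}
      = (if k \<le> b then {1..m + n} else if k \<le> a then {1..m} else {})"
    using assms by (auto simp: part_two_sizes)
  then show ?thesis
    using part_conjugate_part[OF int_partition_two_sizes[OF assms(1,2)] assms(3)] by simp
qed

lemma sum_interval_split:
  fixes f :: "nat \<Rightarrow> nat"
  assumes "i \<le> k" "\<And>j. 1 \<le> j \<Longrightarrow> j \<le> i \<Longrightarrow> f j = x" "\<And>j. i < j \<Longrightarrow> j \<le> k \<Longrightarrow> f j = y"
  shows "(\<Sum>j=1..k. f j) = i * x + (k - i) * y"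
proof -
  have "{1..k} = {1..i} \<union> {i<..k}" using assms(1) by auto
  then have "(\<Sum>j=1..k. f j) = (\<Sum>j=1..i. f j) + (\<Sum>j\<in>{i<..k}. f j)"
    by (simp add: sum.union_disjoint ivl_disj_int)
  also have "(\<Sum>j=1..i. f j) = (\<Sum>j=1..i. x)" using assms(2) by (intro sum.cong) auto
  also have "(\<Sum>j\<in>{i<..k}. f j) = (\<Sum>j\<in>{i<..k}. y)" using assms(3) by (intro sum.cong) auto
  finally show ?thesis by simp
qed

text \<open>The third inequality rearranges to \<open>m * b \<le> b * (b - n) + m * (a - b)\<close>,
  a bound on the total number of choices.\<close>

lemma wide_two_sizes:
  assumes "0 < b" "b < a" and w: "wide (replicate m a @ replicate n b)"
  shows "n \<le> b" "m + n \<le> a" "b * (m + n) \<le> m * (a - b) + b * b"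
proof -
  let ?l = "replicate m a @ replicate n b"
  note ip = int_partition_two_sizes[OF assms(1,2)]
  have "subpartition ?l ?l" using ip by (simp add: subpartition_def)
  then have dom: "dominates ?l (conjugate_part ?l)" using w by (simp add: wide_def)
  have "subpartition (replicate n b) ?l"
    using ip[of 0 n] by (simp add: subpartition_def)
  then have "dominates (replicate n b) (conjugate_part (replicate n b))"
    using w by (simp add: wide_def)
  then show n: "n \<le> b"
    using dominates_conjugate_length_le[of "replicate n b"] ip[of 0 n] by (cases "n = 0") auto
  show mn: "m + n \<le> a"
  proof (cases "m = 0")
    case True
    then show ?thesis using n assms(2) by simp
  next
    case False
    then show ?thesis
      using dominates_conjugate_length_le[OF ip _ dom] by (simp add: nth_append)
  qed
  have sums: "(\<Sum>k=1..j. part (conjugate_part ?l) k) \<le> (\<Sum>k=1..j. part ?l k)" for j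
    using dom unfolding dominates_def by blast
  note ps = part_two_sizes part_conjugate_two_sizes[OF assms(1,2)]
  obtain d where d: "a = b + d" using assms(2) less_imp_add_positive by blast
  \<comment> \<open>Outside the trivial first case, partial sums are compared at the larger of
    \<open>b\<close> and \<open>m\<close>. At \<open>b\<close> this is exactly the claim; at
    \<open>m\<close> it is stronger by the square of \<open>m - b\<close>.\<close>
  consider "m + n \<le> b" | "m \<le> b" "b < m + n" | "b < m" by linarith
  then show "b * (m + n) \<le> m * (a - b) + b * b"
  proof cases
    case 1
    then have "b * (m + n) \<le> b * b" using mult_le_mono2 by blast
    then show ?thesis by linarith
  next
    case 2
    then have "(\<Sum>k=1..b. part ?l k) = m * a + (b - m) * b"
      by (intro sum_interval_split) (auto simp: ps)
    moreover have "(\<Sum>k=1..b. part (conjugate_part ?l) k) = b * (m + n) + (b - b) * 0"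
      by (intro sum_interval_split) (auto simp: ps)
    ultimately have "b * (m + n) \<le> m * a + (b - m) * b" using sums[of b] by simp
    moreover obtain e where "b = m + e" using 2 le_Suc_ex by blast
    ultimately show ?thesis using d by (simp add: algebra_simps)
  next
    case 3
    have "(\<Sum>k=1..m. part ?l k) = m * a + (m - m) * 0"
      by (intro sum_interval_split) (auto simp: ps)
    moreover have "(\<Sum>k=1..m. part (conjugate_part ?l) k) = b * (m + n) + (m - b) * m"
      using 3 mn by (intro sum_interval_split) (auto simp: ps)
    ultimately have "b * (m + n) + (m - b) * m \<le> m * a" using sums[of m] by simp
    moreover obtain e where "m = b + e" using 3 less_imp_add_positive by blast
    ultimately show ?thesis using d by (simp add: algebra_simps)
  qed
qed

lemma latin_two_sizes:
  assumes "0 < b" "b < a" "n \<le> b" "m + n \<le> a" "b * (m + n) \<le> m * (a - b) + b * b"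
  shows "latin (replicate m a @ replicate n b)"
proof -
  let ?l = "replicate m a @ replicate n b"
  obtain d where d: "a = b + d" "0 < d" using assms(2) less_imp_add_positive by blast
  \<comment> \<open>Symbols count from 0 here. A symbol below \<open>b\<close> also occurs in all
    \<open>n\<close> short rows, which leaves it \<open>b - n\<close> of the first \<open>b\<close>
    columns for long rows.\<close>
  define hi where "hi s = (if s < b then min m (b - n) else min m b)" for s :: nat
  have split: "(\<Sum>s<a. f s) = (\<Sum>s<b. f s) + (\<Sum>s\<in>{b..<a}. f s)" for f :: "nat \<Rightarrow> nat"
    using assms(2) sum.atLeastLessThan_concat[of 0 b a f] by (simp add: atLeast0LessThan)
  \<comment> \<open>The last \<open>d\<close> columns hold a symbol at most \<open>d\<close> times,
    so at least \<open>m - d\<close> (truncated at 0) long rows must choose it.\<close>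
  have lo_sum: "(\<Sum>s<a. m - d) \<le> m * b"
  proof (cases "m \<le> d")
    case True
    then show ?thesis by simp
  next
    case False
    then obtain e where e: "m = d + e" using le_Suc_ex nat_le_linear by blast
    then have "e * d \<le> b * d" using assms(4) d by simp
    then show ?thesis using e d by (simp add: algebra_simps)
  qed
  have hi_sum: "m * b \<le> (\<Sum>s<a. hi s)"
  proof -
    have "(\<Sum>s<a. hi s) = b * min m (b - n) + d * min m b"
      unfolding split hi_def using d by simp
    moreover obtain e where e: "b = n + e" using assms(3) le_Suc_ex by blast
    \<comment> \<open>If \<open>m \<le> e\<close>, the first summand suffices. This bound serves
      \<open>e < m \<le> b\<close>, and the next one \<open>b < m\<close>.\<close>
    moreover have "m * b \<le> b * e + d * m"
      using assms(5) d e by (simp add: algebra_simps)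
    moreover have "b * m \<le> b * (e + d)"
      using assms(4) d e by (intro mult_le_mono) auto
    ultimately show ?thesis
      by (auto simp: min_def algebra_simps)
  qed
  have "m - d \<le> hi s" for s
    using assms(4) d by (auto simp: hi_def)
  then obtain t where t: "\<And>s. s < a \<Longrightarrow> m - d \<le> t s \<and> t s \<le> hi s" "(\<Sum>s<a. t s) = m * b"
    using exists_sum_between[of "{..<a}" "\<lambda>_. m - d" hi "m * b"] lo_sum hi_sum
    by auto
  have tm: "t s \<le> m" if "s < a" for s
    using t(1)[OF that] by (auto simp: hi_def split: if_splits)
  obtain P where P: "P \<subseteq> {..<m} \<times> {..<a}" "\<And>r. r < m \<Longrightarrow> card {s. (r, s) \<in> P} = b"
      "\<And>s. s < a \<Longrightarrow> card {r. (r, s) \<in> P} = t s"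
    using exists_relation_with_margins[OF tm t(2)] by blast
  define G where "G = young_diagram ?l"
  have G: "(r, s) \<in> G \<longleftrightarrow> 1 \<le> r \<and> 1 \<le> s \<and> (r \<le> m \<and> s \<le> a \<or> m < r \<and> r \<le> m + n \<and> s \<le> b)" for r s
    by (auto simp: G_def young_diagram_def part_two_sizes)
  \<comment> \<open>\<open>F\<close> holds the pairs (row, symbol) destined for the first
    \<open>b\<close> columns: all those of short rows, and the chosen ones of long rows, with
    indices shifted to start at 1.\<close>
  define F where "F = {(r, s) \<in> G. r \<le> m \<longrightarrow> (r - 1, s - 1) \<in> P}"
  have "G \<subseteq> {1..m + n} \<times> {1..a}" using G assms(2) by auto
  then have "finite G" by (rule finite_subset) simp
  have "F \<subseteq> G" by (auto simp: F_def)
  have finP: "finite {s. (r, s) \<in> P}" "finite {r. (r, s) \<in> P}" for r s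
    using P(1) by (auto intro: finite_subset[of _ "{..<a}"] finite_subset[of _ "{..<m}"])
  have mem_Suc: "k \<in> Suc ` A \<longleftrightarrow> 1 \<le> k \<and> k - 1 \<in> A" for k A
    by (cases k) auto
  have P_bound: "r < m \<and> s < a" if "(r, s) \<in> P" for r s
    using P(1) that by auto
  have F_row: "{s. (r, s) \<in> F} = (if 1 \<le> r \<and> r \<le> m then Suc ` {s. (r - 1, s) \<in> P}
      else if m < r \<and> r \<le> m + n then {1..b} else {})" for r
    unfolding F_def by (auto simp: G mem_Suc dest: P_bound)
  have F_sym: "{r. (r, s) \<in> F} = (if 1 \<le> s \<and> s \<le> a then Suc ` {r. (r, s - 1) \<in> P} \<union>
      (if s \<le> b then {m<..m + n} else {}) else {})" for s
    using assms(2) unfolding F_def by (auto simp: G mem_Suc dest: P_bound)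
  have H_row: "{s. (r, s) \<in> G - F} = (if 1 \<le> r \<and> r \<le> m then {1..a} - Suc ` {s. (r - 1, s) \<in> P} else {})" for r
    unfolding F_def by (auto simp: G mem_Suc dest: P_bound)
  have H_sym: "{r. (r, s) \<in> G - F} = (if 1 \<le> s \<and> s \<le> a then {1..m} - Suc ` {r. (r, s - 1) \<in> P} else {})" for s
    unfolding F_def by (auto simp: G mem_Suc dest: P_bound)
  have "\<exists>c. proper_edge_colouring F {1..b} c"
  proof (rule Koenig_edge_colouring)
    show "finite F" using \<open>F \<subseteq> G\<close> \<open>finite G\<close> by (rule finite_subset)
    show "card {s. (r, s) \<in> F} \<le> card {1..b}" for r
      using P(2)[of "r - 1"] unfolding F_row by (auto simp: card_image)
    show "card {r. (r, s) \<in> F} \<le> card {1..b}" for s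
    proof (cases "1 \<le> s \<and> s \<le> a")
      case True
      then have lt: "s - 1 < a" by linarith
      have "card (Suc ` {r. (r, s - 1) \<in> P}) = t (s - 1)"
        using P(3)[OF lt] by (simp add: card_image)
      \<comment> \<open>Adding the \<open>n\<close> short rows for symbols up to \<open>b\<close>
        brings the degree to at most \<open>b\<close>.\<close>
      moreover have "t (s - 1) \<le> (if s \<le> b then b - n else b)"
        using t(1)[OF lt] True by (auto simp: hi_def split: if_splits)
      ultimately show ?thesis
        using True assms(3) card_Un_le[of "Suc ` {r. (r, s - 1) \<in> P}" "{m<..m + n}"]
        unfolding F_sym by auto
    next
      case False
      then show ?thesis unfolding F_sym by auto
    qed
  qed simp
  then obtain c1 where c1: "proper_edge_colouring F {1..b} c1" by blast
  have "\<exists>c. proper_edge_colouring (G - F) {b<..a} c"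
  proof (rule Koenig_edge_colouring)
    show "finite (G - F)" using \<open>finite G\<close> by simp
    show "card {s. (r, s) \<in> G - F} \<le> card {b<..a}" for r
    proof (cases "1 \<le> r \<and> r \<le> m")
      case True
      then have lt: "r - 1 < m" by linarith
      have "Suc ` {s. (r - 1, s) \<in> P} \<subseteq> {1..a}" using P(1) by auto
      then have "card ({1..a} - Suc ` {s. (r - 1, s) \<in> P}) = a - b"
        using P(2)[OF lt] finP by (simp add: card_Diff_subset card_image)
      then show ?thesis unfolding H_row using True by simp
    next
      case False
      then show ?thesis unfolding H_row by auto
    qed
    show "card {r. (r, s) \<in> G - F} \<le> card {b<..a}" for s
    proof (cases "1 \<le> s \<and> s \<le> a")
      case True
      then have lt: "s - 1 < a" by linarith
      have "Suc ` {r. (r, s - 1) \<in> P} \<subseteq> {1..m}" using P(1) by auto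
      then have "card ({1..m} - Suc ` {r. (r, s - 1) \<in> P}) = m - t (s - 1)"
        using P(3)[OF lt] finP by (simp add: card_Diff_subset card_image)
      moreover have "m - d \<le> t (s - 1)" using t(1)[OF lt] by simp
      ultimately show ?thesis unfolding H_sym using True d by simp
    next
      case False
      then show ?thesis unfolding H_sym by auto
    qed
  qed simp
  then obtain c2 where c2: "proper_edge_colouring (G - F) {b<..a} c2" by blast
  define c where "c r s = (if (r, s) \<in> F then c1 (r, s) else c2 (r, s))" for r s
  note D1 = proper_edge_colouringD[OF c1] and D2 = proper_edge_colouringD[OF c2]
  \<comment> \<open>The colours are column numbers from disjoint ranges, so equal columns always
    come from the same colouring.\<close>
  have c_F: "(r, s) \<in> F \<longleftrightarrow> c r s \<le> b" if "(r, s) \<in> G" for r s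
    using D1(1)[of "(r, s)"] D2(1)[of "(r, s)"] that by (auto simp: c_def)
  show ?thesis
  proof (rule latin_if_column_assignment[of ?l c, folded G_def])
    show "int_partition ?l" by (rule int_partition_two_sizes[OF assms(1,2)])
  next
    fix r s assume rs: "(r, s) \<in> G"
    show "(r, c r s) \<in> G"
    proof (cases "(r, s) \<in> F")
      case True
      then show ?thesis using rs D1(1)[of "(r, s)"] assms(2) by (auto simp: G c_def)
    next
      case False
      then have "r \<le> m" using rs by (auto simp: F_def)
      then show ?thesis using rs False D2(1)[of "(r, s)"] by (auto simp: G c_def)
    qed
  next
    fix r s s' assume *: "(r, s) \<in> G" "(r, s') \<in> G" "c r s = c r s'"
    then have "(r, s) \<in> F \<longleftrightarrow> (r, s') \<in> F" using c_F by simp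
    then show "s = s'" using * D1(2) D2(2) by (auto simp: c_def split: if_splits)
  next
    fix r r' s assume *: "(r, s) \<in> G" "(r', s) \<in> G" "c r s = c r' s"
    then have "(r, s) \<in> F \<longleftrightarrow> (r', s) \<in> F" using c_F by simp
    then show "r = r'" using * D1(3) D2(3) by (auto simp: c_def split: if_splits)
  qed
qed

theorem theorem3:
  fixes l :: "nat list"
  assumes "int_partition l"
    and "wide l"
    and "card (set l) \<le> 2"
  shows "latin l"
proof -
  obtain a b m n where "0 < b" "b < a" "l = replicate m a @ replicate n b"
    using two_part_sizes assms(1,3) .
  with wide_two_sizes[of b a m n] assms(2) show ?thesis
    using latin_two_sizes[of b a n m] by simp
qed

end
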